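(* Let $p$ be a prime, $n\geq 3$, and $V$ an $n$-dimensional vector space over $\mathbb{F}_p$. Let $X\subseteq SL(V)$ be a symmetric generating set of $SL(V)$ (i.e. $X=X^{-1}$) with $1\in X$, and suppose $X$ contains a transvection $t$. Let $$\mathcal{C}_n=\{x_n\cdots x_1\, t\, x_1^{-1}\cdots x_n^{-1}\,:\,x_1,\ldots,x_n\in X\}=\{r_1=t,r_2,\ldots,r_m\},$$ and write $r_i=1+v_i\otimes\phi_i$ for $1\le i\le m$. Then $\langle v_1,\ldots,v_m\rangle=V$, and the transvection graph $\Gamma(\mathcal{C}_n)$ contains a directed cycle.
   Context: A transvection is an element $1+d\otimes\phi\in SL(V)$, acting by $x\mapsto x+\phi(x)d$, with $0\neq d\in V$, $0\neq\phi\in V^*$, $\phi(d)=0$. For a set $Y$ of transvections, the transvection graph $\Gamma(Y)$ is the directed graph with vertex set $Y\setminus\{1\}$ and a directed edge from $1+d_1\otimes\phi_1$ to $1+d_2\otimes\phi_2$ if and only if $\phi_2(d_1)\neq 0$. *)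

theory Defs
  imports "HOL-Analysis.Analysis"
begin

text \<open>V = 'a^'n, with 'a a finite field of prime cardinality p (i.e. F_p) and CARD('n) = n.
  Linear maps of V are matrices 'a^'n^'n acting by (*v).\<close>

definition SL :: "('a::field ^ 'n ^ 'n) set" where
  "SL = {A. det A = 1}"

definition pairing :: "'a::field ^ 'n \<Rightarrow> 'a ^ 'n \<Rightarrow> 'a" where
  "pairing \<phi> x = (\<Sum>i\<in>UNIV. \<phi> $ i * x $ i)"

text \<open>The matrix of the map x \<mapsto> phi(x) d.\<close>
definition tensor :: "'a::field ^ 'n \<Rightarrow> 'a ^ 'n \<Rightarrow> 'a ^ 'n ^ 'n" where
  "tensor d \<phi> = (\<chi> i j. d $ i * \<phi> $ j)"

text \<open>M = 1 + d \<otimes> phi is a transvection with data d, phi.\<close>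
definition transv_rep :: "'a::field ^ 'n ^ 'n \<Rightarrow> 'a ^ 'n \<Rightarrow> 'a ^ 'n \<Rightarrow> bool" where
  "transv_rep M d \<phi> \<longleftrightarrow> d \<noteq> 0 \<and> \<phi> \<noteq> 0 \<and> pairing \<phi> d = 0 \<and> M = mat 1 + tensor d \<phi>"

definition is_transvection :: "'a::field ^ 'n ^ 'n \<Rightarrow> bool" where
  "is_transvection M \<longleftrightarrow> (\<exists>d \<phi>. transv_rep M d \<phi>)"

text \<open>Edge relation of the transvection graph.\<close>
definition tv_edge :: "'a::field ^ 'n ^ 'n \<Rightarrow> 'a ^ 'n ^ 'n \<Rightarrow> bool" where
  "tv_edge M N \<longleftrightarrow> (\<exists>d1 \<phi>1 d2 \<phi>2. transv_rep M d1 \<phi>1 \<and> transv_rep N d2 \<phi>2 \<and> pairing \<phi>2 d1 \<noteq> 0)"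

text \<open>The transvection graph Gamma(Y) (vertex set Y - {1}) contains a directed cycle.\<close>
definition tv_graph_has_cycle :: "('a::field ^ 'n ^ 'n) set \<Rightarrow> bool" where
  "tv_graph_has_cycle Y \<longleftrightarrow> (\<exists>cs. length cs \<ge> 2 \<and> distinct cs \<and> set cs \<subseteq> Y - {mat 1} \<and>
      (\<forall>i < length cs. tv_edge (cs ! i) (cs ! ((i + 1) mod length cs))))"

text \<open>Subgroup of GL generated by a set of matrices.\<close>
inductive_set generated :: "('a::field ^ 'n ^ 'n) set \<Rightarrow> ('a ^ 'n ^ 'n) set" for X where
  gen_one: "mat 1 \<in> generated X"
| gen_base: "x \<in> X \<Longrightarrow> x \<in> generated X"
| gen_mult: "a \<in> generated X \<Longrightarrow> b \<in> generated X \<Longrightarrow> a ** b \<in> generated X"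
| gen_inv: "a \<in> generated X \<Longrightarrow> matrix_inv a \<in> generated X"

text \<open>words X k = {x_k ** ... ** x_1 | x_i in X}.\<close>
fun words :: "('a::field ^ 'n ^ 'n) set \<Rightarrow> nat \<Rightarrow> ('a ^ 'n ^ 'n) set" where
  "words X 0 = {mat 1}"
| "words X (Suc k) = {x ** w | x w. x \<in> X \<and> w \<in> words X k}"

text \<open>C_k = {x_k...x_1 t x_1^-1 ... x_k^-1}.\<close>
definition conj_set :: "('a::field ^ 'n ^ 'n) set \<Rightarrow> nat \<Rightarrow> 'a ^ 'n ^ 'n \<Rightarrow> ('a ^ 'n ^ 'n) set" where
  "conj_set X k t = {w ** t ** matrix_inv w | w. w \<in> words X k}"

end

theory Submission
  imports Defs
begin

(* For a transvection r = 1 + v_r (x) phi_r the image of r - 1 is the line through v_r, so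
   <v_r : r in C_k> is the span W_k of all displacements r x - x with r in C_k.  Conjugating by
   x in X maps W_k into W_(k+1), so the chain W_0 <= W_1 <= ... grows strictly until some W_k is
   X-invariant, hence SL(V)-invariant, hence all of V, because the elementary transvections move
   any nonzero vector onto every coordinate axis.  As W_0 <> 0, this happens by k = n - 1.
   If Gamma(C_n) had no directed cycle, some vertex r would have no incoming edge: phi_r would
   vanish on every v_s, hence on V, which is absurd. *)

lemma matrix_inv_inverse:
  fixes A :: "'a::field^'n^'n"
  assumes "invertible A"
  shows matrix_inv_right: "A ** matrix_inv A = mat 1"
    and matrix_inv_left: "matrix_inv A ** A = mat 1"
  using someI_ex[OF assms[unfolded invertible_def]] unfolding matrix_inv_def by auto

lemma matrix_inv_unique:
  fixes A B :: "'a::field^'n^'n"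
  assumes "A ** B = mat 1"
  shows "matrix_inv A = B"
proof -
  have "B ** A = mat 1" using assms matrix_left_right_inverse by blast
  then have A: "invertible A" using assms unfolding invertible_def by blast
  have "matrix_inv A = matrix_inv A ** (A ** B)"
    by (simp add: assms)
  then show ?thesis by (simp add: matrix_mul_assoc matrix_inv_left[OF A])
qed

lemma matrix_inv_mat_1 [simp]: "matrix_inv (mat 1 :: 'a::field^'n^'n) = mat 1"
  by (rule matrix_inv_unique) simp

lemma matrix_inv_mult:
  fixes A B :: "'a::field^'n^'n"
  assumes "invertible A" "invertible B"
  shows "matrix_inv (A ** B) = matrix_inv B ** matrix_inv A"
proof (rule matrix_inv_unique)
  have "A ** B ** (matrix_inv B ** matrix_inv A) = A ** (B ** matrix_inv B) ** matrix_inv A"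
    by (simp add: matrix_mul_assoc)
  then show "A ** B ** (matrix_inv B ** matrix_inv A) = mat 1"
    by (simp add: assms matrix_inv_right)
qed

lemma invertible_matrix_inv:
  fixes A :: "'a::field^'n^'n"
  assumes "invertible A"
  shows "invertible (matrix_inv A)" and "matrix_inv (matrix_inv A) = A"
proof -
  show "matrix_inv (matrix_inv A) = A"
    using assms by (intro matrix_inv_unique matrix_inv_left)
  then show "invertible (matrix_inv A)"
    using assms invertible_right_inverse matrix_inv_left by metis
qed

lemma SL_invertible: "A \<in> SL \<Longrightarrow> invertible (A::'a::field^'n^'n)"
  unfolding SL_def by (simp add: invertible_det_nz)

lemma matrix_vector_mul_matrix_inv_cancel:
  fixes A :: "'a::field^'n^'n"
  assumes "invertible A"
  shows "matrix_inv A *v (A *v x) = x" and "A *v (matrix_inv A *v x) = x"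
  by (simp_all add: matrix_vector_mul_assoc matrix_inv_left matrix_inv_right assms)

lemma pairing_add: "pairing \<phi> (x + y) = pairing \<phi> x + pairing \<phi> y"
  by (simp add: pairing_def distrib_left sum.distrib)

lemma pairing_scale: "pairing \<phi> (c *s x) = c * pairing \<phi> x"
  by (simp add: pairing_def sum_distrib_left mult_ac)

lemma subspace_pairing_kernel: "vec.subspace {x. pairing \<phi> x = 0}"
  unfolding vec.subspace_def by (simp add: pairing_add pairing_scale) (simp add: pairing_def)

lemma pairing_axis_right: "pairing \<phi> (axis i 1) = \<phi> $ i"
proof -
  have "pairing \<phi> (axis i 1) = (\<Sum>k\<in>UNIV. if k = i then \<phi>$k else 0)"
    unfolding pairing_def by (rule sum.cong) (auto simp: axis_def)
  then show ?thesis by simp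
qed

lemma pairing_axis_left: "pairing (axis i c) x = c * x $ i"
proof -
  have "pairing (axis i c) x = (\<Sum>k\<in>UNIV. if k = i then c * x$k else 0)"
    unfolding pairing_def by (rule sum.cong) (auto simp: axis_def)
  then show ?thesis by simp
qed

lemma pairing_vector_matrix_mult: "pairing (\<phi> v* A) x = pairing \<phi> (A *v x)"
proof -
  have "pairing (\<phi> v* A) x = (\<Sum>j\<in>UNIV. \<Sum>i\<in>UNIV. \<phi>$i * A$i$j * x$j)"
    unfolding pairing_def vector_matrix_mult_def by (simp add: sum_distrib_right)
  also have "\<dots> = (\<Sum>i\<in>UNIV. \<Sum>j\<in>UNIV. \<phi>$i * A$i$j * x$j)"
    by (rule sum.swap)
  finally show ?thesis
    unfolding pairing_def matrix_vector_mult_def by (simp add: sum_distrib_left mult_ac)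
qed

lemma pairing_eq_zero_iff: "(\<forall>x. pairing \<phi> x = 0) \<longleftrightarrow> \<phi> = 0"
proof
  assume "\<forall>x. pairing \<phi> x = 0"
  then have "\<phi> $ i = 0" for i
    by (metis pairing_axis_right)
  then show "\<phi> = 0" by (simp add: vec_eq_iff)
qed (simp add: pairing_def)

lemma tensor_apply: "tensor d \<phi> *v x = pairing \<phi> x *s d"
  by (simp add: vec_eq_iff tensor_def matrix_vector_mult_def pairing_def sum_distrib_left mult_ac)

lemma transv_rep_apply: "transv_rep M d \<phi> \<Longrightarrow> M *v x = x + pairing \<phi> x *s d"
  unfolding transv_rep_def by (simp add: matrix_vector_mult_add_rdistrib tensor_apply)

lemma transv_rep_apply_direction:
  assumes "transv_rep M d \<phi>"
  shows "M *v d = d"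
proof -
  have "pairing \<phi> d = 0" using assms by (simp add: transv_rep_def)
  then show ?thesis by (simp add: transv_rep_apply[OF assms])
qed

lemma transv_rep_neq_mat_1:
  assumes M: "transv_rep M d \<phi>"
  shows "M \<noteq> mat 1"
proof
  assume "M = mat 1"
  then have "pairing \<phi> x *s d = 0" for x
    using transv_rep_apply[OF M, of x] by simp
  then have "\<forall>x. pairing \<phi> x = 0"
    using M by (simp add: transv_rep_def)
  then show False
    using M by (simp add: pairing_eq_zero_iff transv_rep_def)
qed

lemma not_tv_edge_refl: "\<not> tv_edge M M"
proof
  assume "tv_edge M M"
  then obtain d1 \<phi>1 d2 \<phi>2 where M1: "transv_rep M d1 \<phi>1" and M2: "transv_rep M d2 \<phi>2"
    and edge: "pairing \<phi>2 d1 \<noteq> 0"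
    unfolding tv_edge_def by blast
  have "pairing \<phi>2 d1 *s d2 = 0"
    using transv_rep_apply[OF M2, of d1] transv_rep_apply_direction[OF M1] by simp
  then show False
    using edge M2 by (simp add: transv_rep_def)
qed

lemma transv_rep_conjugate:
  fixes w :: "'a::field^'n^'n"
  assumes w: "invertible w" and M: "transv_rep M d \<phi>"
  shows "transv_rep (w ** M ** matrix_inv w) (w *v d) (\<phi> v* matrix_inv w)"
proof -
  let ?w' = "matrix_inv w"
  have "w *v d \<noteq> 0"
    using M matrix_vector_mul_matrix_inv_cancel(1)[OF w, of d] unfolding transv_rep_def by force
  moreover have "\<phi> v* ?w' \<noteq> 0"
  proof
    assume "\<phi> v* ?w' = 0"
    have "\<phi> = (\<phi> v* ?w') v* w"
      by (simp add: vector_matrix_mul_assoc matrix_inv_left[OF w])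
    then show False
      using M \<open>\<phi> v* ?w' = 0\<close> by (simp add: transv_rep_def)
  qed
  moreover have "pairing (\<phi> v* ?w') (w *v d) = 0"
    using M w by (simp add: pairing_vector_matrix_mult matrix_vector_mul_matrix_inv_cancel transv_rep_def)
  moreover have "w ** M ** ?w' = mat 1 + tensor (w *v d) (\<phi> v* ?w')"
  proof (rule iffD2[OF matrix_eq], rule allI)
    fix x
    have "(w ** M ** ?w') *v x = w *v (?w' *v x + pairing \<phi> (?w' *v x) *s d)"
      using transv_rep_apply[OF M] by (simp add: matrix_vector_mul_assoc[symmetric])
    also have "\<dots> = x + pairing \<phi> (?w' *v x) *s (w *v d)"
      by (simp add: matrix_vector_right_distrib matrix_vector_mul_matrix_inv_cancel w
          vec.scale[symmetric])
    finally show "(w ** M ** ?w') *v x = (mat 1 + tensor (w *v d) (\<phi> v* ?w')) *v x"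
      by (simp add: matrix_vector_mult_add_rdistrib tensor_apply pairing_vector_matrix_mult)
  qed
  ultimately show ?thesis using M unfolding transv_rep_def by blast
qed

lemma elementary_transvection_in_SL:
  fixes i j :: "'n::finite" and c :: "'a::field"
  assumes "i \<noteq> j"
  shows "mat 1 + tensor (axis j 1) (axis i c) \<in> (SL :: ('a^'n^'n) set)"
proof -
  let ?I = "mat 1 :: 'a^'n^'n"
  have "mat 1 + tensor (axis j 1) (axis i c)
      = (\<chi> k. if k = j then row j ?I + c *s row i ?I else row k ?I)"
    by (auto simp: vec_eq_iff tensor_def axis_def mat_def row_def)
  moreover have "det (\<chi> k. if k = j then row j ?I + c *s row i ?I else row k ?I) = det ?I"
    using assms by (intro det_row_operation) auto
  ultimately show ?thesis by (simp add: SL_def)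
qed

lemma SL_invariant_subspace_eq_UNIV:
  fixes W :: "('a::field^'n) set"
  assumes W: "vec.subspace W" "W \<noteq> {0}" and SL_W: "\<forall>A\<in>SL. \<forall>w\<in>W. A *v w \<in> W"
    and "CARD('n) \<ge> 2"
  shows "W = UNIV"
proof -
  have axis_in_W: "(c * w$i) *s axis j 1 \<in> W" if "w \<in> W" "i \<noteq> j" for w i j c
  proof -
    let ?E = "mat 1 + tensor (axis j 1) (axis i c) :: 'a^'n^'n"
    have "?E *v w \<in> W"
      using SL_W elementary_transvection_in_SL[OF \<open>i \<noteq> j\<close>] \<open>w \<in> W\<close> by blast
    then have "?E *v w - w \<in> W"
      using \<open>w \<in> W\<close> by (rule vec.subspace_diff[OF W(1)])
    then show ?thesis
      by (simp add: matrix_vector_mult_add_rdistrib tensor_apply pairing_axis_left)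
  qed
  obtain w where w: "w \<in> W" "w \<noteq> 0"
    using W vec.subspace_0 by blast
  then obtain i where i: "w$i \<noteq> 0"
    by (metis vec_eq_iff zero_index)
  have other_axes: "axis j 1 \<in> W" if "j \<noteq> i" for j
    using axis_in_W[OF w(1) that[symmetric], of "inverse (w$i)"] i by simp
  have "\<not> (UNIV :: 'n set) \<subseteq> {i}"
    using card_mono[of "{i}" "UNIV :: 'n set"] \<open>CARD('n) \<ge> 2\<close> by auto
  then obtain j where "j \<noteq> i" by blast
  then have "axis i 1 \<in> W"
    using axis_in_W[OF other_axes[OF \<open>j \<noteq> i\<close>] \<open>j \<noteq> i\<close>, where c = 1] by (simp add: axis_def)
  then have "axis k 1 \<in> W" for k
    using other_axes by (cases "k = i") auto
  then have "(\<Sum>k\<in>UNIV. x$k *s axis k 1) \<in> W" for x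
    by (intro vec.subspace_sum[OF W(1)] vec.subspace_scale[OF W(1)])
  then show ?thesis
    by (auto simp: basis_expansion)
qed

lemma generated_invariant:
  fixes X :: "('a::field^'n^'n) set"
  assumes "X \<subseteq> SL" and "\<forall>x\<in>X. matrix_inv x \<in> X"
    and X_W: "\<forall>x\<in>X. \<forall>w\<in>W. x *v w \<in> W" and "A \<in> generated X"
  shows "\<forall>w\<in>W. A *v w \<in> W"
proof -
  have "invertible A \<and> (\<forall>w\<in>W. A *v w \<in> W) \<and> (\<forall>w\<in>W. matrix_inv A *v w \<in> W)"
    using \<open>A \<in> generated X\<close>
  proof induction
    case gen_one
    then show ?case by (simp add: invertible_def)
  next
    case (gen_base x)
    then show ?case using assms(1,2) X_W SL_invertible by blast
  next
    case (gen_mult a b)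
    then show ?case
      by (simp add: invertible_mult matrix_inv_mult flip: matrix_vector_mul_assoc)
  next
    case (gen_inv a)
    then show ?case by (simp add: invertible_matrix_inv)
  qed
  then show ?thesis by blast
qed

lemma words_SL: "X \<subseteq> SL \<Longrightarrow> w \<in> words X k \<Longrightarrow> w \<in> (SL :: ('a::field^'n^'n) set)"
  by (induction k arbitrary: w) (auto simp: SL_def det_mul)

lemma mat_1_in_words: "mat 1 \<in> X \<Longrightarrow> mat 1 \<in> words X k"
  by (induction k) force+

lemma words_mono:
  assumes "mat 1 \<in> X"
  shows "words X k \<subseteq> words X (Suc k)"
proof
  fix w assume "w \<in> words X k"
  then show "w \<in> words X (Suc k)"
  proof (induction k arbitrary: w)
    case 0
    then show ?case using assms by force
  next
    case (Suc k)
    then obtain x w' where "w = x ** w'" "x \<in> X" "w' \<in> words X k" by auto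
    then show ?case using Suc.IH by (subst words.simps(2)) blast
  qed
qed

lemma self_in_conj_set: "mat 1 \<in> X \<Longrightarrow> t \<in> conj_set X k t"
  unfolding conj_set_def using mat_1_in_words by force

lemma conj_set_mono: "mat 1 \<in> X \<Longrightarrow> conj_set X k t \<subseteq> conj_set X (Suc k) t"
  unfolding conj_set_def using words_mono by blast

lemma conj_set_Suc:
  assumes "X \<subseteq> SL" "x \<in> X" "r \<in> conj_set X k t"
  shows "x ** r ** matrix_inv x \<in> conj_set X (Suc k) t"
proof -
  obtain w where w: "w \<in> words X k" "r = w ** t ** matrix_inv w"
    using assms(3) unfolding conj_set_def by auto
  have "invertible x" "invertible w"
    using assms(1,2) words_SL[OF assms(1) w(1)] SL_invertible by auto
  then have "x ** r ** matrix_inv x = (x ** w) ** t ** matrix_inv (x ** w)"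
    using w(2) by (simp add: matrix_inv_mult matrix_mul_assoc)
  moreover have "x ** w \<in> words X (Suc k)"
    using assms(2) w(1) by auto
  ultimately show ?thesis
    unfolding conj_set_def by blast
qed

lemma conj_set_is_transvection:
  assumes "X \<subseteq> SL" "is_transvection t" "r \<in> conj_set X k t"
  shows "is_transvection r"
proof -
  obtain w where "w \<in> words X k" "r = w ** t ** matrix_inv w"
    using assms(3) unfolding conj_set_def by auto
  then show ?thesis
    using assms(1,2) words_SL SL_invertible transv_rep_conjugate
    unfolding is_transvection_def by metis
qed

(* The paper's <v_r : r in Y>, which for transvections does not depend on the choice of the v_r. *)
definition displacement_span :: "('a::field^'n^'n) set \<Rightarrow> ('a^'n) set" where
  "displacement_span Y = vec.span {r *v y - y | r y. r \<in> Y}"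

lemma displacement_span_mono: "Y \<subseteq> Z \<Longrightarrow> displacement_span Y \<subseteq> displacement_span Z"
  unfolding displacement_span_def by (intro vec.span_mono) blast

lemma displacement_span_subset_span_directions:
  assumes "\<forall>r\<in>Y. transv_rep r (v r) (\<phi> r)"
  shows "displacement_span Y \<subseteq> vec.span (v ` Y)"
  unfolding displacement_span_def
proof (rule vec.span_minimal)
  show "{r *v y - y | r y. r \<in> Y} \<subseteq> vec.span (v ` Y)"
  proof clarify
    fix r y assume "r \<in> Y"
    then have "r *v y - y = pairing (\<phi> r) y *s v r"
      using assms transv_rep_apply by fastforce
    then show "r *v y - y \<in> vec.span (v ` Y)"
      using \<open>r \<in> Y\<close> by (simp add: vec.span_scale vec.span_base)
  qed
qed simp

lemma displacement_span_conj_set_Suc: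
  assumes "X \<subseteq> SL" "x \<in> X"
  shows "(*v) x ` displacement_span (conj_set X k t) \<subseteq> displacement_span (conj_set X (Suc k) t)"
proof -
  have "invertible x"
    using assms SL_invertible by blast
  then have "x *v (r *v y - y) = (x ** r ** matrix_inv x) *v (x *v y) - x *v y" for r y
    by (simp add: matrix_vector_mult_diff_distrib matrix_vector_mul_matrix_inv_cancel
        flip: matrix_vector_mul_assoc)
  then have "(*v) x ` {r *v y - y | r y. r \<in> conj_set X k t}
      \<subseteq> {r *v y - y | r y. r \<in> conj_set X (Suc k) t}"
    using conj_set_Suc[OF assms] by blast
  then show ?thesis
    unfolding displacement_span_def vec.span_image[symmetric] by (rule vec.span_mono)
qed

lemma displacement_span_neq_zero:
  assumes "t \<in> Y" "t \<noteq> mat 1"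
  shows "displacement_span Y \<noteq> {0}"
proof -
  obtain y where "t *v y \<noteq> y"
    using assms(2) matrix_eq[of t "mat 1"] by auto
  moreover have "t *v y - y \<in> displacement_span Y"
    unfolding displacement_span_def using assms(1) by (blast intro: vec.span_base)
  ultimately show ?thesis by force
qed

lemma subspace_chain_eq_UNIV:
  fixes W :: "nat \<Rightarrow> ('a::field^'n) set"
  assumes sub: "\<And>k. vec.subspace (W k)" and mono: "\<And>k. W k \<subseteq> W (Suc k)"
    and stop: "\<And>k. W (Suc k) \<subseteq> W k \<Longrightarrow> W k = UNIV" and "W 0 \<noteq> {0}"
  shows "W (CARD('n) - 1) = UNIV"
proof -
  have span_W: "vec.span (W k) = W k" for k
    using sub vec.span_eq_iff by blast
  have "W k = UNIV \<or> k < vec.dim (W k)" for k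
  proof (induction k)
    case 0
    have "\<not> W 0 \<subseteq> {0}"
      using \<open>W 0 \<noteq> {0}\<close> vec.subspace_0[OF sub] by blast
    then have "vec.dim (W 0) \<noteq> 0"
      using vec.dim_eq_0[of "W 0"] by blast
    then show ?case using not_gr0 by blast
  next
    case (Suc k)
    show ?case
    proof (cases "W k = UNIV")
      case True
      then show ?thesis using mono[of k] by auto
    next
      case False
      then have "W k \<subset> W (Suc k)"
        using mono stop by blast
      then have "vec.dim (W k) < vec.dim (W (Suc k))"
        by (intro vec.dim_psubset) (simp add: span_W)
      then show ?thesis using Suc.IH False by simp
    qed
  qed
  from this[of "CARD('n) - 1"]
  have "W (CARD('n) - 1) = UNIV \<or> vec.dim (W (CARD('n) - 1)) = CARD('n)"
    using dim_subset_UNIV_cart_gen[of "W (CARD('n) - 1)"] by auto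
  then show ?thesis
    using vec.dim_eq_full[of "W (CARD('n) - 1)"]
    by (auto simp: span_W vec.dimension_def card_cart_basis)
qed

lemma displacement_span_conj_set_eq_UNIV:
  fixes X :: "('a::field^'n^'n) set"
  assumes X: "X \<subseteq> SL" "\<forall>x\<in>X. matrix_inv x \<in> X" "generated X = SL" "mat 1 \<in> X"
    and "t \<noteq> mat 1" and "CARD('n) \<ge> 2"
  shows "displacement_span (conj_set X (CARD('n) - 1) t) = UNIV"
proof (rule subspace_chain_eq_UNIV)
  fix k
  show "vec.subspace (displacement_span (conj_set X k t))"
    by (simp add: displacement_span_def)
  show "displacement_span (conj_set X k t) \<subseteq> displacement_span (conj_set X (Suc k) t)"
    by (intro displacement_span_mono conj_set_mono X(4))
  have nonzero: "displacement_span (conj_set X k t) \<noteq> {0}" for k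
    using displacement_span_neq_zero self_in_conj_set X(4) \<open>t \<noteq> mat 1\<close> by blast
  then show "displacement_span (conj_set X 0 t) \<noteq> {0}" .
  assume stable: "displacement_span (conj_set X (Suc k) t) \<subseteq> displacement_span (conj_set X k t)"
  then have "\<forall>x\<in>X. \<forall>w\<in>displacement_span (conj_set X k t). x *v w \<in> displacement_span (conj_set X k t)"
    using displacement_span_conj_set_Suc[OF X(1)] by blast
  then have "\<forall>A\<in>SL. \<forall>w\<in>displacement_span (conj_set X k t). A *v w \<in> displacement_span (conj_set X k t)"
    using generated_invariant[OF X(1,2)] X(3) by blast
  then show "displacement_span (conj_set X k t) = UNIV"
    using nonzero \<open>CARD('n) \<ge> 2\<close>
    by (intro SL_invariant_subspace_eq_UNIV) (simp_all add: displacement_span_def)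
qed

lemma funpow_least_period:
  assumes "(f ^^ q) y = y" "0 < q"
  obtains p where "0 < p" "(f ^^ p) y = y" "inj_on (\<lambda>k. (f ^^ k) y) {..<p}"
proof -
  define p where "p = (LEAST p. 0 < p \<and> (f ^^ p) y = y)"
  have p: "0 < p" "(f ^^ p) y = y"
    using LeastI[of "\<lambda>p. 0 < p \<and> (f ^^ p) y = y" q] assms unfolding p_def by auto
  moreover have "inj_on (\<lambda>k. (f ^^ k) y) {..<p}"
  proof (rule linorder_inj_onI')
    fix m n assume "m \<in> {..<p}" "n \<in> {..<p}" "m < n"
    show "(f ^^ m) y \<noteq> (f ^^ n) y"
    proof
      assume eq: "(f ^^ m) y = (f ^^ n) y"
      have "(f ^^ (p - n + m)) y = (f ^^ (p - n)) ((f ^^ n) y)"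
        by (simp add: funpow_add eq)
      also have "\<dots> = (f ^^ (p - n + n)) y"
        by (simp add: funpow_add)
      also have "\<dots> = y"
        using p \<open>n \<in> {..<p}\<close> by simp
      finally have "(f ^^ (p - n + m)) y = y" .
      moreover have "p - n + m < p" "0 < p - n + m"
        using \<open>m < n\<close> \<open>n \<in> {..<p}\<close> by auto
      ultimately show False
        unfolding p_def using not_less_Least by blast
    qed
  qed
  ultimately show ?thesis
    using that by blast
qed

lemma finite_funpow_periodic_point:
  assumes "finite S" "f ` S \<subseteq> S" "x \<in> S"
  obtains y q where "y \<in> S" "0 < q" "(f ^^ q) y = y"
proof -
  have orbit: "(f ^^ k) x \<in> S" for k
    using assms by (induction k) auto
  have "\<not> inj_on (\<lambda>k. (f ^^ k) x) {..card S}"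
  proof
    assume "inj_on (\<lambda>k. (f ^^ k) x) {..card S}"
    then have "card {..card S} \<le> card S"
      using card_inj_on_le[of _ "{..card S}" S] orbit assms(1) by blast
    then show False by simp
  qed
  then obtain a b where "a < b" "(f ^^ a) x = (f ^^ b) x"
    unfolding inj_on_def by (metis linorder_neqE_nat)
  have "(f ^^ (b - a)) ((f ^^ a) x) = (f ^^ (b - a + a)) x"
    by (simp add: funpow_add)
  also have "\<dots> = (f ^^ a) x"
    using \<open>a < b\<close> \<open>(f ^^ a) x = (f ^^ b) x\<close> by simp
  finally have "(f ^^ (b - a)) ((f ^^ a) x) = (f ^^ a) x" .
  moreover have "0 < b - a"
    using \<open>a < b\<close> by simp
  ultimately show ?thesis
    using that[OF orbit[of a]] by blast
qed

lemma finite_predecessors_imp_cycle: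
  assumes "finite S" "S \<noteq> {}" and pred: "\<forall>r\<in>S. \<exists>s\<in>S. E s r" and irrefl: "\<forall>r\<in>S. \<not> E r r"
  shows "\<exists>cs. 2 \<le> length cs \<and> distinct cs \<and> set cs \<subseteq> S \<and>
    (\<forall>i < length cs. E (cs ! i) (cs ! ((i + 1) mod length cs)))"
proof -
  obtain f where f: "\<forall>r\<in>S. f r \<in> S \<and> E (f r) r"
    using pred by metis
  obtain y q where "y \<in> S" "0 < q" "(f ^^ q) y = y"
    using finite_funpow_periodic_point[OF assms(1)] f assms(2) by blast
  then obtain p where p: "0 < p" "(f ^^ p) y = y" and inj: "inj_on (\<lambda>k. (f ^^ k) y) {..<p}"
    using funpow_least_period by metis
  have orbit: "(f ^^ k) y \<in> S" for k
    using f \<open>y \<in> S\<close> by (induction k) auto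
  have "p \<noteq> 1"
    using p f irrefl \<open>y \<in> S\<close> by fastforce
  \<comment> \<open>The periodic orbit of the predecessor map, listed backwards so that edges point forward.\<close>
  define cs where "cs = rev (map (\<lambda>k. (f ^^ k) y) [0..<p])"
  have len: "length cs = p"
    by (simp add: cs_def)
  have nth: "cs ! i = (f ^^ (p - Suc i)) y" if "i < p" for i
    using that by (simp add: cs_def rev_nth)
  have step: "cs ! i = f (cs ! ((i + 1) mod p))" if "i < p" for i
  proof (cases "i + 1 < p")
    case True
    then have "p - Suc i = Suc (p - Suc (Suc i))" by arith
    then show ?thesis using True nth that by simp
  next
    case False
    then have "i = p - 1" using that by simp
    have "f ((f ^^ (p - 1)) y) = (f ^^ Suc (p - 1)) y"
      by simp
    then show ?thesis
      using nth p \<open>i = p - 1\<close> by simp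
  qed
  show ?thesis
  proof (intro exI conjI allI impI)
    show "2 \<le> length cs" using len p \<open>p \<noteq> 1\<close> by simp
    show "distinct cs"
      using inj by (simp add: cs_def distinct_map atLeast0LessThan)
    show "set cs \<subseteq> S"
      using orbit by (auto simp: cs_def)
    fix i assume "i < length cs"
    then show "E (cs ! i) (cs ! ((i + 1) mod length cs))"
      using step[of i] f orbit nth len by (metis mod_less_divisor p(1))
  qed
qed

lemma in_edge_if_span_directions_eq_UNIV:
  assumes reps: "\<forall>s\<in>Y. transv_rep s (v s) (\<psi> s)" and span: "vec.span (v ` Y) = UNIV"
    and r: "transv_rep r d \<phi>"
  shows "\<exists>s\<in>Y. tv_edge s r"
proof (rule ccontr)
  assume "\<not> (\<exists>s\<in>Y. tv_edge s r)"
  then have "v ` Y \<subseteq> {x. pairing \<phi> x = 0}"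
    using reps r unfolding tv_edge_def by blast
  then have "vec.span (v ` Y) \<subseteq> {x. pairing \<phi> x = 0}"
    by (rule vec.span_minimal[OF _ subspace_pairing_kernel])
  then have "\<phi> = 0"
    using span pairing_eq_zero_iff by blast
  then show False
    using r by (simp add: transv_rep_def)
qed

lemma tv_graph_has_cycle_if_in_edges:
  assumes "finite Y" "Y \<noteq> {}" "\<forall>r\<in>Y. is_transvection r" "\<forall>r\<in>Y. \<exists>s\<in>Y. tv_edge s r"
  shows "tv_graph_has_cycle Y"
proof -
  have "Y - {mat 1} = Y"
    using assms(3) transv_rep_neq_mat_1 unfolding is_transvection_def by blast
  then show ?thesis
    unfolding tv_graph_has_cycle_def
    using finite_predecessors_imp_cycle[OF assms(1,2,4) ballI[OF not_tv_edge_refl]] by simp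
qed

theorem theorem3p1:
  fixes X :: "('a::{field,finite} ^ 'n ^ 'n) set" and t :: "'a ^ 'n ^ 'n" and p n :: nat
  assumes "prime p" and "CARD('a) = p"
    and "CARD('n) = n" and "n \<ge> 3"
    and "X \<subseteq> SL" and "\<forall>x\<in>X. matrix_inv x \<in> X" and "generated X = SL"
    and "mat 1 \<in> X"
    and "t \<in> X" and "is_transvection t"
  shows "(\<forall>v \<phi>. (\<forall>r\<in>conj_set X n t. transv_rep r (v r) (\<phi> r))
              \<longrightarrow> vec.span (v ` conj_set X n t) = UNIV)
         \<and> tv_graph_has_cycle (conj_set X n t)"
proof -
  let ?C = "conj_set X n t"
  have "t \<noteq> mat 1"
    using assms(10) transv_rep_neq_mat_1 unfolding is_transvection_def by blast
  then have "displacement_span (conj_set X (n - 1) t) = UNIV"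
    using displacement_span_conj_set_eq_UNIV[OF assms(5-8)] assms(3,4) by simp
  moreover have "conj_set X (n - 1) t \<subseteq> ?C"
    using conj_set_mono[OF assms(8), of "n - 1" t] assms(4) by simp
  ultimately have "displacement_span ?C = UNIV"
    using displacement_span_mono by blast
  then have span: "\<forall>v \<phi>. (\<forall>r\<in>?C. transv_rep r (v r) (\<phi> r)) \<longrightarrow> vec.span (v ` ?C) = UNIV"
    using displacement_span_subset_span_directions by blast
  have transvections: "\<forall>r\<in>?C. is_transvection r"
    using conj_set_is_transvection assms(5,10) by blast
  then obtain v \<psi> where reps: "\<forall>r\<in>?C. transv_rep r (v r) (\<psi> r)"
    unfolding is_transvection_def by metis
  have "tv_graph_has_cycle ?C"
  proof (rule tv_graph_has_cycle_if_in_edges)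
    show "finite ?C" "?C \<noteq> {}" "\<forall>r\<in>?C. is_transvection r"
      using self_in_conj_set[OF assms(8)] transvections by auto
    show "\<forall>r\<in>?C. \<exists>s\<in>?C. tv_edge s r"
      using in_edge_if_span_directions_eq_UNIV[OF reps] span reps by blast
  qed
  with span show ?thesis by blast
qed

end
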